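(* Let $m$ be a positive integer, $A=\{0,1,\ldots,m\}$ and $q\in(m,m+1)$. Let $P$ be the set of bases $q\in(m,m+1)$ satisfying one of the equalities $$1=\frac{m}{q}+\cdots+\frac{m}{q^n}+\frac{p}{q^{n+1}},\qquad n\in\mathbb{N}=\{1,2,\ldots\},\ p\in\{1,\ldots,m\}.$$ Then: (i) If $q\in P$, then each $x\in J_{A,q}=[0,m/(q-1)]$ has an optimal expansion. (ii) If $q\in(m,m+1)\setminus P$, then the set of numbers $x\in J_{A,q}$ having an optimal expansion is nowhere dense and has Lebesgue measure zero.
   Context: An expansion of $x$ in base $q$ with respect to the alphabet $A$ is a sequence $(c_i)_{i\ge1}$ with $c_i\in A$ and $\sum_{i=1}^\infty c_iq^{-i}=x$; every $x\in J_{A,q}=[0,m/(q-1)]$ has at least one expansion. For an expansion $(c_i)$ of $x$, its errors are $\theta_n((c_i))=q^n\bigl(x-\sum_{i=1}^n c_iq^{-i}\bigr)$, $n\in\mathbb{N}$. An expansion $(d_i)$ of $x$ is called optimal if $\theta_n((d_i))\le\theta_n((c_i))$ for every $n\in\mathbb{N}$ and every expansion $(c_i)$ of $x$. *)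

theory Defs
  imports "HOL-Analysis.Analysis"
begin

definition alphabet :: "nat \<Rightarrow> nat set" where
  "alphabet m = {0..m}"

definition J_interval :: "nat \<Rightarrow> real \<Rightarrow> real set" where
  "J_interval m q = {0..real m / (q - 1)}"

text \<open>Digit sequences are indexed from 1; the value of such a sequence at 0 is irrelevant.\<close>

definition is_expansion :: "nat set \<Rightarrow> real \<Rightarrow> real \<Rightarrow> (nat \<Rightarrow> nat) \<Rightarrow> bool" where
  "is_expansion A q x c \<longleftrightarrow>
     (\<forall>i\<ge>1. c i \<in> A) \<and> (\<lambda>i. real (c (Suc i)) / q ^ Suc i) sums x"

definition expansion_error :: "real \<Rightarrow> real \<Rightarrow> (nat \<Rightarrow> nat) \<Rightarrow> nat \<Rightarrow> real" where
  "expansion_error q x c n = q ^ n * (x - (\<Sum>i=1..n. real (c i) / q ^ i))"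

definition is_optimal_expansion :: "nat set \<Rightarrow> real \<Rightarrow> real \<Rightarrow> (nat \<Rightarrow> nat) \<Rightarrow> bool" where
  "is_optimal_expansion A q x d \<longleftrightarrow>
     is_expansion A q x d \<and>
     (\<forall>c. is_expansion A q x c \<longrightarrow>
        (\<forall>n\<ge>1. expansion_error q x d n \<le> expansion_error q x c n))"

definition base_set_P :: "nat \<Rightarrow> real set" where
  "base_set_P m =
     {q \<in> {real m<..<real m + 1}.
        \<exists>n\<ge>1. \<exists>p\<in>{1..m}. 1 = (\<Sum>i=1..n. real m / q ^ i) + real p / q ^ (n + 1)}"

definition nowhere_dense :: "'a::topological_space set \<Rightarrow> bool" where
  "nowhere_dense S \<longleftrightarrow> interior (closure S) = {}"

end

theory Submission
  imports Defs
begin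

text \<open>
  An optimal expansion must be the greedy one, whose errors are the orbit of the greedy map
  \<open>T\<close>, so it suffices to decide whether greedy errors are minimal. If \<open>q \<in> P\<close>, then
  \<open>q\<^sup>k\<close> can be subtracted from the value of any word of length \<open>k\<close> that is at least \<open>q\<^sup>k\<close>,
  leaving again the value of a word of length \<open>k\<close>. These carries raise the leading digits of an
  expansion to the greedy ones without increasing its error. If \<open>q \<notin> P\<close>, some word of length \<open>N\<close>
  has a value strictly between \<open>q\<^sup>N\<close> and \<open>q\<^sup>N + 1\<close>. For \<open>x\<close> slightly above the value of this
  word, divided by \<open>q\<^sup>N\<^sup>+\<^sup>1\<close>, the greedy expansion starts with the digit 1 followed by \<open>N\<close> zeros
  and has a larger error. Hence the \<open>T\<close>-orbit of a number with an optimal expansion avoids a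
  fixed interval in \<open>[0,1)\<close>.

  Let \<open>Z\<close> be the set of points whose orbit avoids this interval and let \<open>u\<close> be the measure of
  \<open>Z \<inter> [0,1)\<close>. Self-similarity shows that \<open>Z\<close> meets every interval in \<open>[0,1)\<close> with density at
  most \<open>u\<close>. As it misses an interval of positive length, \<open>u = 0\<close>. Since the iterates of \<open>T\<close> are
  locally affine to the right of each point, the complement of \<open>Z\<close> contains a right neighbourhood
  of each of its points, so the null set \<open>Z\<close> is also nowhere dense.
\<close>

section \<open>Values of digit words, errors of expansions, and carries\<close>

text \<open>The last digit has weight 1. The recursion splits off the leading digit, just as
  shifting an expansion does.\<close>

primrec word_values :: "nat \<Rightarrow> real \<Rightarrow> nat \<Rightarrow> real set" where
  "word_values m q 0 = {0}"
| "word_values m q (Suc k) = {real b * q ^ k + v | b v. b \<le> m \<and> v \<in> word_values m q k}"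

text \<open>\<open>one_remainder m q i / q ^ i\<close> is the remainder of 1 after \<open>i\<close> digits \<open>m\<close>; it may be negative.\<close>

primrec one_remainder :: "nat \<Rightarrow> real \<Rightarrow> nat \<Rightarrow> real" where
  "one_remainder m q 0 = 1"
| "one_remainder m q (Suc i) = q * one_remainder m q i - real m"

lemma word_values_ConsI:
  assumes "b \<le> m" "v \<in> word_values m q k" "u = real b * q ^ k + v"
  shows "u \<in> word_values m q (Suc k)"
  using assms by auto

lemma sum_one_remainder:
  assumes "q > 0"
  shows "(\<Sum>i=1..n. real m / q ^ i) = 1 - one_remainder m q n / q ^ n"
proof (induction n)
  case (Suc n)
  have "(\<Sum>i=1..Suc n. real m / q ^ i) = 1 - one_remainder m q n / q ^ n + real m / q ^ Suc n"
    using Suc.IH by simp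
  then show ?case using assms by (simp add: field_simps)
qed simp

lemma expansion_error_0 [simp]: "expansion_error q x c 0 = x"
  by (simp add: expansion_error_def)

lemma expansion_error_Suc:
  assumes "q > 0"
  shows "expansion_error q x c (Suc n) = q * expansion_error q x c n - real (c (Suc n))"
  using assms by (simp add: expansion_error_def field_simps)

lemma expansion_error_shift:
  assumes "q > 0"
  shows "expansion_error q x c (Suc n) = expansion_error q (q * x - real (c 1)) (\<lambda>i. c (Suc i)) n"
  using assms by (induction n) (auto simp: expansion_error_Suc)

lemma is_expansion_iff_shift:
  assumes "q > 0"
  shows "is_expansion A q x c \<longleftrightarrow>
    c 1 \<in> A \<and> is_expansion A q (q * x - real (c 1)) (\<lambda>i. c (Suc i))"
proof -
  have digits: "(\<forall>i\<ge>1. c i \<in> A) \<longleftrightarrow> c 1 \<in> A \<and> (\<forall>i\<ge>1. c (Suc i) \<in> A)"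
    by (metis One_nat_def Suc_le_mono le0 not0_implies_Suc not_one_le_zero)
  have "(\<lambda>i. real (c (Suc i)) / q ^ Suc i) sums x \<longleftrightarrow>
      (\<lambda>i. real (c (Suc (Suc i))) / q ^ Suc (Suc i)) sums (x - real (c 1) / q)"
    using sums_Suc_iff[of "\<lambda>i. real (c (Suc i)) / q ^ Suc i" "x - real (c 1) / q"] by simp
  also have "\<dots> \<longleftrightarrow> (\<lambda>i. q * (real (c (Suc (Suc i))) / q ^ Suc (Suc i))) sums
      (q * (x - real (c 1) / q))"
    using assms by (subst sums_mult_iff) auto
  also have "\<dots> \<longleftrightarrow> (\<lambda>i. real (c (Suc (Suc i))) / q ^ Suc i) sums (q * x - real (c 1))"
    using assms by (simp add: right_diff_distrib)
  finally show ?thesis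
    unfolding is_expansion_def digits by blast
qed

lemma is_expansion_nonneg:
  assumes "q > 0" "is_expansion A q x c"
  shows "0 \<le> x"
proof (rule sums_le[OF _ sums_zero])
  show "(\<lambda>i. real (c (Suc i)) / q ^ Suc i) sums x"
    using assms(2) by (simp add: is_expansion_def)
qed (use assms(1) in auto)

text \<open>The first \<open>k\<close> digits scaled by \<open>q ^ k\<close> form a word, and the
  error is the value of the remaining digits. Comparing errors thus means comparing word
  values.\<close>

lemma expansion_error_word_values:
  assumes "q > 0" "is_expansion (alphabet m) q x c"
  shows "0 \<le> expansion_error q x c k \<and> q ^ k * x - expansion_error q x c k \<in> word_values m q k"
  using assms(2)
proof (induction k arbitrary: x c)
  case 0
  then show ?case using is_expansion_nonneg[OF assms(1)] by auto
next
  case (Suc k)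
  define y where "y = q * x - real (c 1)"
  have y: "c 1 \<le> m" "is_expansion (alphabet m) q y (\<lambda>i. c (Suc i))"
    using Suc.prems unfolding is_expansion_iff_shift[OF assms(1), of _ x] y_def
    by (auto simp: alphabet_def)
  have "q ^ Suc k * x - expansion_error q x c (Suc k) =
      real (c 1) * q ^ k + (q ^ k * y - expansion_error q y (\<lambda>i. c (Suc i)) k)"
    unfolding expansion_error_shift[OF assms(1)] y_def by (simp add: algebra_simps)
  then have "q ^ Suc k * x - expansion_error q x c (Suc k) \<in> word_values m q (Suc k)"
    using Suc.IH[OF y(2)] y(1) by (blast intro: word_values_ConsI)
  then show ?case
    using Suc.IH[OF y(2)] expansion_error_shift[OF assms(1), of x c k] by (simp add: y_def)
qed

lemma word_values_nonneg: "q > 0 \<Longrightarrow> v \<in> word_values m q k \<Longrightarrow> 0 \<le> v"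
  by (induction k arbitrary: v) auto

lemma zero_in_word_values: "0 \<in> word_values m q k"
  by (induction k) force+

lemma word_values_snoc:
  assumes "v \<in> word_values m q k" "b \<le> m"
  shows "q * v + real b \<in> word_values m q (Suc k)"
  using assms(1)
proof (induction k arbitrary: v)
  case 0
  then show ?case using assms(2) by force
next
  case (Suc k)
  then obtain a v' where a: "a \<le> m" "v' \<in> word_values m q k" "v = real a * q ^ k + v'"
    by auto
  have "q * v + real b = real a * q ^ Suc k + (q * v' + real b)"
    using a(3) by (simp add: algebra_simps)
  then show ?case using Suc.IH[OF a(2)] a(1) by (blast intro: word_values_ConsI)
qed

lemma pow_in_word_values:
  assumes "1 \<le> m"
  shows "q ^ k \<in> word_values m q (Suc k)"
  using assms zero_in_word_values[of m q k] by force

text \<open>This number is the value of the word made of \<open>k\<close> digits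
  \<open>m\<close>.\<close>

lemma pow_minus_one_remainder_in_word_values:
  "q ^ k - one_remainder m q k \<in> word_values m q k"
proof (induction k)
  case (Suc k)
  have "q ^ Suc k - one_remainder m q (Suc k) = q * (q ^ k - one_remainder m q k) + real m"
    by (simp add: algebra_simps)
  then show ?case using word_values_snoc[OF Suc] by (metis order_refl)
qed auto

lemma word_values_append:
  assumes "v \<in> word_values m q k" "w \<in> word_values m q l"
  shows "v * q ^ l + w \<in> word_values m q (k + l)"
  using assms(1)
proof (induction k arbitrary: v)
  case (Suc k)
  then obtain a v' where a: "a \<le> m" "v' \<in> word_values m q k" "v = real a * q ^ k + v'"
    by auto
  have "v * q ^ l + w = real a * q ^ (k + l) + (v' * q ^ l + w)"
    using a(3) by (simp add: algebra_simps power_add)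
  then show ?case
    unfolding add_Suc using Suc.IH[OF a(2)] a(1) by (blast intro: word_values_ConsI)
qed (use assms(2) in auto)

text \<open>The case \<open>i = 0\<close> is the carry; the other remainders make the induction on the word length work.\<close>

lemma word_values_borrow:
  assumes "q > 0" and rem_pos: "\<And>i. i \<le> n \<Longrightarrow> 0 < one_remainder m q i"
    and last_digit: "q * one_remainder m q n = real p" "p \<le> m"
  shows "\<lbrakk>i \<le> n; v \<in> word_values m q k; one_remainder m q i * q ^ k \<le> v\<rbrakk>
    \<Longrightarrow> v - one_remainder m q i * q ^ k \<in> word_values m q k"
proof (induction k arbitrary: i v)
  case 0
  then show ?case using rem_pos[of i] by auto
next
  case (Suc k)
  obtain b v' where b: "b \<le> m" "v' \<in> word_values m q k" "v = real b * q ^ k + v'"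
    using Suc.prems(2) by auto
  note IH = Suc.IH
  \<comment> \<open>Each of the \<open>j\<close> subtractions is the case \<open>i = 0\<close> of
    the hypothesis for length \<open>k\<close>.\<close>
  have borrow: "real j * q ^ k \<le> v' \<Longrightarrow> v' - real j * q ^ k \<in> word_values m q k" for j
  proof (induction j)
    case (Suc j)
    have "0 \<le> q ^ k" using assms(1) by simp
    then have "v' - real j * q ^ k \<in> word_values m q k" "q ^ k \<le> v' - real j * q ^ k"
      using Suc by (auto simp: algebra_simps)
    then show ?case using Suc.prems IH[of 0 "v' - real j * q ^ k"]
      by (simp add: algebra_simps)
  qed (use b(2) in simp)
  \<comment> \<open>Leading digit \<open>a\<close> and rest \<open>r\<close> of the subtrahend:
    \<open>m\<close> and the next remainder if \<open>i < n\<close>, but \<open>p\<close> and 0 if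
    \<open>i = n\<close>.\<close>
  obtain a r where a: "a \<le> m" "q * one_remainder m q i = real a + r" "0 \<le> r" "r = 0 \<or> a = m"
    and r: "\<And>u. u \<in> word_values m q k \<Longrightarrow> r * q ^ k \<le> u \<Longrightarrow> u - r * q ^ k \<in> word_values m q k"
  proof (cases "i = n")
    case True
    then show ?thesis using that[of p 0] last_digit by simp
  next
    case False
    then show ?thesis
      using that[of m "one_remainder m q (Suc i)"] Suc.IH[of "Suc i"] Suc.prems(1) rem_pos[of "Suc i"]
      by auto
  qed
  have lead: "one_remainder m q i * q ^ Suc k = real a * q ^ k + r * q ^ k"
  proof -
    have "one_remainder m q i * q ^ Suc k = (q * one_remainder m q i) * q ^ k" by simp
    then show ?thesis by (simp only: a(2) distrib_right)
  qed
  \<comment> \<open>If \<open>a \<le> b\<close>, the leading digits are subtracted directly; a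
    nonzero \<open>r\<close> forces \<open>a = b = m\<close>, so \<open>v'\<close> is large enough.
    Otherwise the leading digit becomes 0 and the missing \<open>a - b\<close> copies of
    \<open>q ^ k\<close> are taken from \<open>v'\<close>.\<close>
  show ?case
  proof (cases "a \<le> b")
    case True
    have "r * q ^ k \<le> v'"
    proof (cases "r = 0")
      case True
      then show ?thesis using word_values_nonneg[OF assms(1) b(2)] by simp
    next
      case False
      then have "a = b" using a(4) b(1) True by simp
      then show ?thesis using Suc.prems(3) lead b(3) by simp
    qed
    then show ?thesis
      unfolding lead b(3) using True b(1) by (intro word_values_ConsI[OF _ r[OF b(2)], of "b - a"])
        (auto simp: of_nat_diff algebra_simps simp del: power_Suc)
  next
    case False
    have le: "real (a - b) * q ^ k + r * q ^ k \<le> v'"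
      using Suc.prems(3) False unfolding lead b(3) by (simp add: of_nat_diff algebra_simps)
    moreover have "0 \<le> r * q ^ k"
      using a(3) assms(1) by simp
    ultimately have "v' - real (a - b) * q ^ k \<in> word_values m q k"
      by (intro borrow) simp
    then show ?thesis
      unfolding lead b(3) using False le
      by (intro word_values_ConsI[OF _ r, of 0 "v' - real (a - b) * q ^ k"])
        (auto simp: of_nat_diff algebra_simps simp del: power_Suc)
  qed
qed

lemma lmeasurable_affine_image:
  fixes S :: "real set"
  assumes "S \<in> lmeasurable"
  shows "(\<lambda>x. c *\<^sub>R x + d) ` S \<in> lmeasurable"
proof (rule fmeasurableI)
  show "(\<lambda>x. c *\<^sub>R x + d) ` S \<in> sets lebesgue"
    using assms by (intro differentiable_image_in_sets_lebesgue derivative_intros) auto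
  show "emeasure lebesgue ((\<lambda>x. c *\<^sub>R x + d) ` S) < \<infinity>"
    using assms fmeasurableD2[OF assms] unfolding emeasure_lebesgue_affine
    by (simp add: ennreal_mult_less_top less_top)
qed

section \<open>The greedy map and greedy expansions\<close>

locale noninteger_base =
  fixes m :: nat and q :: real
  assumes m_ge: "1 \<le> m" and q_gt: "real m < q" and q_lt: "q < real m + 1"
begin

lemma q_gt_1: "1 < q"
  using m_ge q_gt by linarith

lemma q_pos: "0 < q"
  using q_gt_1 by linarith

definition jmax :: real where
  "jmax = real m / (q - 1)"

lemma jmax_eq: "q * jmax = jmax + real m"
  using q_gt_1 by (simp add: jmax_def field_simps)

lemma jmax_gt_1: "1 < jmax"
  using q_gt_1 q_lt by (simp add: jmax_def field_simps)

text \<open>On [0,1) the cap at \<open>m\<close> is inactive because \<open>q * x < m + 1\<close>;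
  for larger \<open>x\<close> it keeps the digit in the alphabet.\<close>

definition greedy_digit :: "real \<Rightarrow> nat" where
  "greedy_digit x = min m (nat \<lfloor>q * x\<rfloor>)"

definition greedy_map :: "real \<Rightarrow> real" where
  "greedy_map x = q * x - real (greedy_digit x)"

lemma greedy_digit_le: "greedy_digit x \<le> m"
  by (simp add: greedy_digit_def)

lemma le_greedy_digit:
  assumes "b \<le> m" "real b \<le> q * x"
  shows "b \<le> greedy_digit x"
  using assms by (simp add: greedy_digit_def le_nat_floor nat_le_iff le_nat_iff le_floor_iff)

lemma greedy_map_eq:
  assumes "b \<le> m" "real b \<le> q * x" "q * x < real b + 1 \<or> b = m"
  shows "greedy_map x = q * x - real b"
proof -
  have "greedy_digit x = b"
  proof (cases "b = m")
    case True
    then show ?thesis using le_greedy_digit[OF assms(1,2)] greedy_digit_le[of x] by simp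
  next
    case False
    then have "\<lfloor>q * x\<rfloor> = int b" using assms by (intro floor_unique) auto
    then show ?thesis using assms(1) by (simp add: greedy_digit_def)
  qed
  then show ?thesis by (simp add: greedy_map_def)
qed

lemma greedy_map_nonneg:
  assumes "0 \<le> x"
  shows "0 \<le> greedy_map x"
proof -
  have "real (greedy_digit x) \<le> real (nat \<lfloor>q * x\<rfloor>)"
    by (simp add: greedy_digit_def)
  also have "\<dots> \<le> q * x"
    using assms q_pos by (simp add: of_nat_floor)
  finally show ?thesis by (simp add: greedy_map_def)
qed

lemma greedy_map_cases:
  assumes "0 \<le> x"
  obtains "q * x < real (greedy_digit x) + 1" | "greedy_digit x = m"
proof (cases "nat \<lfloor>q * x\<rfloor> \<le> m")
  case True
  then have "real (greedy_digit x) = real_of_int \<lfloor>q * x\<rfloor>"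
    using assms q_pos by (simp add: greedy_digit_def min_def)
  then show ?thesis using that(1) by linarith
next
  case False
  then show ?thesis using that(2) by (simp add: greedy_digit_def)
qed

lemma greedy_map_less_1:
  assumes "0 \<le> x" "x < 1"
  shows "greedy_map x < 1"
proof -
  have "q * x < real m + 1"
    using assms q_pos q_lt by (smt (verit) mult_less_cancel_left1)
  with assms(1) show ?thesis
    by (cases rule: greedy_map_cases) (auto simp: greedy_map_def)
qed

text \<open>An uncapped step lands below 1, hence below \<open>jmax\<close>; the step with digit
  \<open>m\<close> is increasing and fixes \<open>jmax\<close>.\<close>

lemma greedy_map_le_jmax:
  assumes "0 \<le> x" "x \<le> jmax"
  shows "greedy_map x \<le> jmax"
proof -
  have "q * x \<le> jmax + real m"
    using assms q_pos jmax_eq by (metis mult_left_mono less_imp_le)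
  with assms(1) show ?thesis
    using jmax_gt_1 by (cases rule: greedy_map_cases) (auto simp: greedy_map_def)
qed

lemma funpow_greedy_map_range:
  assumes "0 \<le> x" "x \<le> jmax"
  shows "0 \<le> (greedy_map ^^ n) x \<and> (greedy_map ^^ n) x \<le> jmax"
  using assms by (induction n) (auto intro: greedy_map_nonneg greedy_map_le_jmax)

definition greedy_expansion :: "real \<Rightarrow> nat \<Rightarrow> nat" where
  "greedy_expansion x i = greedy_digit ((greedy_map ^^ (i - 1)) x)"

lemma expansion_error_greedy: "expansion_error q x (greedy_expansion x) n = (greedy_map ^^ n) x"
  by (induction n)
    (auto simp: expansion_error_Suc[OF q_pos] greedy_expansion_def greedy_map_def[of "(_ ^^ _) _"])

text \<open>The errors are iterates of the greedy map and stay in \<open>{0..jmax}\<close>, so the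
  partial sums miss \<open>x\<close> by at most \<open>jmax / q ^ n\<close>.\<close>

lemma is_expansion_greedy:
  assumes "0 \<le> x" "x \<le> jmax"
  shows "is_expansion (alphabet m) q x (greedy_expansion x)"
proof -
  let ?c = "greedy_expansion x"
  have partial: "(\<Sum>i<n. real (?c (Suc i)) / q ^ Suc i) = x - (greedy_map ^^ n) x * (1 / q) ^ n" for n
  proof -
    have "(\<Sum>i<n. real (?c (Suc i)) / q ^ Suc i) = (\<Sum>i=1..n. real (?c i) / q ^ i)"
      by (induction n) auto
    then show ?thesis
      using expansion_error_greedy[of x n] q_pos
      by (simp add: expansion_error_def field_simps)
  qed
  have "(\<lambda>n. (greedy_map ^^ n) x * (1 / q) ^ n) \<longlonglongrightarrow> 0"
  proof (rule tendsto_sandwich[of "\<lambda>_. 0"])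
    show "(\<lambda>n. jmax * (1 / q) ^ n) \<longlonglongrightarrow> 0"
      using q_gt_1 by (intro tendsto_mult_right_zero LIMSEQ_power_zero) auto
  qed (use funpow_greedy_map_range[OF assms] q_pos in
      \<open>auto intro!: always_eventually mult_right_mono simp del: power_one_over\<close>)
  then have "(\<lambda>n. x - (greedy_map ^^ n) x * (1 / q) ^ n) \<longlonglongrightarrow> x - 0"
    by (intro tendsto_intros)
  then have "(\<lambda>i. real (?c (Suc i)) / q ^ Suc i) sums x"
    unfolding sums_def partial by simp
  then show ?thesis
    using greedy_digit_le by (auto simp: is_expansion_def alphabet_def greedy_expansion_def)
qed

text \<open>Converse to \<open>expansion_error_word_values\<close>: the word is continued by the
  greedy expansion of \<open>y\<close>, so every admissible error occurs behind every word.\<close>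

lemma word_values_extend:
  assumes "v \<in> word_values m q k" "0 \<le> y" "y \<le> jmax"
  shows "\<exists>c. is_expansion (alphabet m) q ((v + y) / q ^ k) c \<and>
    expansion_error q ((v + y) / q ^ k) c k = y"
  using assms(1)
proof (induction k arbitrary: v)
  case 0
  then show ?case using is_expansion_greedy[OF assms(2,3)] by auto
next
  case (Suc k)
  then obtain b v' where b: "b \<le> m" "v' \<in> word_values m q k" "v = real b * q ^ k + v'"
    by auto
  obtain c where c: "is_expansion (alphabet m) q ((v' + y) / q ^ k) c"
    "expansion_error q ((v' + y) / q ^ k) c k = y"
    using Suc.IH[OF b(2)] by blast
  define d where "d i = (if i = 1 then b else c (i - 1))" for i
  have shift: "is_expansion A q x (\<lambda>i. d (Suc i)) = is_expansion A q x c"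
    "expansion_error q x (\<lambda>i. d (Suc i)) n = expansion_error q x c n" for A x n
    by (auto simp: is_expansion_def expansion_error_def d_def intro!: sum.cong)
  have "q * ((v + y) / q ^ Suc k) - real (d 1) = (v' + y) / q ^ k"
    using b(3) q_pos by (simp add: d_def field_simps)
  then have "is_expansion (alphabet m) q ((v + y) / q ^ Suc k) d"
    "expansion_error q ((v + y) / q ^ Suc k) d (Suc k) = y"
    unfolding is_expansion_iff_shift[OF q_pos, of _ _ d] expansion_error_shift[OF q_pos]
    using c b(1) shift by (auto simp: d_def alphabet_def)
  then show ?case by blast
qed

section \<open>Optimality of greedy expansions for bases in \<open>base_set_P m\<close>\<close>

text \<open>Carries raise the leading digit of a competing word to the greedy digit one unit at a
  time, without changing its value. The induction on the length then handles the remaining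
  digits.\<close>

lemma funpow_greedy_map_le:
  assumes borrow: "\<And>k v. v \<in> word_values m q k \<Longrightarrow> q ^ k \<le> v \<Longrightarrow> v - q ^ k \<in> word_values m q k"
  shows "\<lbrakk>0 \<le> x; v \<in> word_values m q k; v \<le> q ^ k * x\<rbrakk> \<Longrightarrow> (greedy_map ^^ k) x \<le> q ^ k * x - v"
proof (induction k arbitrary: x v)
  case 0
  then show ?case by simp
next
  case (Suc k)
  let ?d = "greedy_digit x" and ?y = "greedy_map x"
  have y: "q ^ k * ?y = q ^ Suc k * x - real ?d * q ^ k" "0 \<le> ?y"
    using greedy_map_nonneg[OF Suc.prems(1)] by (simp_all add: greedy_map_def algebra_simps)
  note IH = Suc.IH[OF y(2)]
  have main: "(greedy_map ^^ k) ?y \<le> q ^ Suc k * x - (real b * q ^ k + u)"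
    if "b \<le> ?d" "u \<in> word_values m q k" "real b * q ^ k + u \<le> q ^ Suc k * x" for b u
    using that
  proof (induction "?d - b" arbitrary: b u)
    case 0
    then show ?case using IH[of u] y(1) by simp
  next
    case (Suc j)
    show ?case
    proof (cases "q ^ k \<le> u")
      case True
      have "(greedy_map ^^ k) ?y \<le> q ^ Suc k * x - (real (Suc b) * q ^ k + (u - q ^ k))"
        using Suc.hyps(2) Suc.prems(3) borrow[OF Suc.prems(2) True]
        by (intro Suc.hyps(1)) (auto simp: algebra_simps simp del: power_Suc)
      then show ?thesis by (simp add: algebra_simps)
    next
      case False
      \<comment> \<open>Without a carry the word is worth at most \<open>?d * q ^ k\<close>, so the
        greedy digit followed by zeros does no worse.\<close>
      have "real (Suc b) * q ^ k \<le> real ?d * q ^ k"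
        using Suc.hyps(2) q_pos by (intro mult_right_mono) auto
      then have "real b * q ^ k + u \<le> real ?d * q ^ k"
        using False by (simp add: algebra_simps)
      moreover have "(greedy_map ^^ k) ?y \<le> q ^ k * ?y - 0"
        using y(2) q_pos by (intro IH zero_in_word_values) auto
      ultimately show ?thesis using y(1) by simp
    qed
  qed
  obtain b u where b: "b \<le> m" "u \<in> word_values m q k" "v = real b * q ^ k + u"
    using Suc.prems(2) by auto
  have "real b * q ^ k \<le> (q * x) * q ^ k"
    using Suc.prems(3) word_values_nonneg[OF q_pos b(2)] unfolding b(3) by (simp add: algebra_simps)
  then have "b \<le> ?d"
    using q_pos by (intro le_greedy_digit b(1)) simp
  then show ?case
    using main[OF _ b(2)] Suc.prems(3) unfolding b(3) funpow_Suc_right by simp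
qed

lemma base_set_P_iff:
  "q \<in> base_set_P m \<longleftrightarrow> (\<exists>n\<ge>1. \<exists>p\<in>{1..m}. q * one_remainder m q n = real p)"
proof -
  have "1 = (\<Sum>i=1..n. real m / q ^ i) + real p / q ^ (n + 1) \<longleftrightarrow>
      q * one_remainder m q n = real p" for n p
    unfolding sum_one_remainder[OF q_pos] using q_pos by (auto simp: field_simps)
  then show ?thesis
    using q_gt q_lt by (simp add: base_set_P_def)
qed

lemma is_optimal_expansion_greedy:
  assumes "q \<in> base_set_P m" "0 \<le> x" "x \<le> jmax"
  shows "is_optimal_expansion (alphabet m) q x (greedy_expansion x)"
proof -
  obtain n p where np: "p \<in> {1..m}" "q * one_remainder m q n = real p"
    using assms(1) unfolding base_set_P_iff by blast
  \<comment> \<open>Positivity descends from \<open>n\<close>, since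
    \<open>q * one_remainder m q i\<close> is the next remainder plus \<open>m\<close>.\<close>
  have "0 < one_remainder m q i" if "i \<le> n" for i
    using that
  proof (induction rule: inc_induct)
    case base
    have "0 < q * one_remainder m q n" using np by simp
    then show ?case using q_pos by (simp add: zero_less_mult_iff)
  next
    case (step i)
    then have "0 < q * one_remainder m q i" by simp
    then show ?case using q_pos by (simp add: zero_less_mult_iff)
  qed
  then have borrow: "v \<in> word_values m q k \<Longrightarrow> q ^ k \<le> v \<Longrightarrow> v - q ^ k \<in> word_values m q k" for v k
    using word_values_borrow[OF q_pos, of n m p 0 v k] np by simp
  have "(greedy_map ^^ k) x \<le> expansion_error q x c k"
    if c: "is_expansion (alphabet m) q x c" for c k
    using funpow_greedy_map_le[OF borrow assms(2),
        where k = k and v = "q ^ k * x - expansion_error q x c k"]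
      expansion_error_word_values[OF q_pos c, of k] by simp
  then show ?thesis
    using is_expansion_greedy[OF assms(2,3)]
    by (simp add: is_optimal_expansion_def expansion_error_greedy)
qed

section \<open>A forbidden interval for the greedy orbits of optimally expandable numbers\<close>

text \<open>If the errors agree so far, nonnegativity of the next error bounds the next digit by the
  greedy one. Optimality against the greedy expansion gives the reverse inequality.\<close>

lemma expansion_error_optimal:
  assumes "is_optimal_expansion (alphabet m) q x d" "0 \<le> x" "x \<le> jmax"
  shows "expansion_error q x d n = (greedy_map ^^ n) x"
proof (induction n)
  case (Suc n)
  let ?y = "(greedy_map ^^ n) x"
  have d: "is_expansion (alphabet m) q x d"
    using assms(1) by (simp add: is_optimal_expansion_def)
  have err: "expansion_error q x d (Suc n) = q * ?y - real (d (Suc n))"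
    using Suc by (simp add: expansion_error_Suc[OF q_pos])
  have "d (Suc n) \<le> greedy_digit ?y"
    using expansion_error_word_values[OF q_pos d, of "Suc n"] err d
    by (intro le_greedy_digit) (auto simp: is_expansion_def alphabet_def)
  then have "greedy_map ?y \<le> expansion_error q x d (Suc n)"
    unfolding err by (simp add: greedy_map_def)
  moreover have "expansion_error q x d (Suc n) \<le> greedy_map ?y"
    using assms(1) is_expansion_greedy[OF assms(2,3)] expansion_error_greedy[of x "Suc n"]
    unfolding is_optimal_expansion_def by (metis One_nat_def Suc_le_mono comp_apply funpow.simps(2) le0)
  ultimately show ?case by simp
qed simp

lemma funpow_greedy_map_small:
  assumes "0 \<le> y" "q ^ N * y < 1" "j \<le> N"
  shows "(greedy_map ^^ j) y = q ^ j * y"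
  using assms(3)
proof (induction j)
  case (Suc j)
  have "q ^ Suc j * y \<le> q ^ N * y"
    using Suc.prems q_gt_1 assms(1) by (intro mult_right_mono power_increasing) auto
  then have "q * (q ^ j * y) < 1"
    using assms(2) by (simp add: mult.assoc)
  then have "greedy_map (q ^ j * y) = q * (q ^ j * y) - real 0"
    using assms(1) q_pos by (intro greedy_map_eq) auto
  then show ?case using Suc by (simp add: mult.assoc)
qed simp

text \<open>From a point \<open>y\<close> of the interval the greedy digits are 1 and
  \<open>N\<close> zeros, with error \<open>q ^ Suc N * y - q ^ N\<close>. The digit 0 followed by
  the word for \<open>w\<close> leaves the smaller error \<open>q ^ Suc N * y - w\<close>.\<close>

lemma optimal_orbit_avoids:
  assumes w: "w \<in> word_values m q N" "q ^ N < w"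
    and d: "is_optimal_expansion (alphabet m) q x d" "0 \<le> x" "x \<le> jmax"
  shows "(greedy_map ^^ k) x \<notin> {w / q ^ Suc N..<(q ^ N + 1) / q ^ Suc N}"
proof
  define y where "y = (greedy_map ^^ k) x"
  assume "(greedy_map ^^ k) x \<in> {w / q ^ Suc N..<(q ^ N + 1) / q ^ Suc N}"
  then have y: "w \<le> q ^ Suc N * y" "q ^ Suc N * y < q ^ N + 1"
    using q_pos by (auto simp: y_def field_simps)
  have y0: "0 \<le> y"
    using funpow_greedy_map_range[OF d(2,3)] by (simp add: y_def)
  define e where "e = q ^ Suc N * y - w"
  have N1: "1 \<le> q ^ N"
    using q_gt_1 by (simp add: one_le_power)
  have "q ^ N * 1 < q ^ N * (q * y)" "q ^ N * (q * y) < q ^ N * 2"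
    using w(2) y N1 by (simp_all only: power_Suc2 mult.assoc)
  then have qy: "1 \<le> q * y" "q * y < 2"
    using q_pos by simp_all
  have step: "greedy_map y = q * y - real 1"
    using qy m_ge by (intro greedy_map_eq) auto
  have "q ^ N * (q * y - 1) < 1"
    using y(2) by (simp add: algebra_simps)
  then have T: "(greedy_map ^^ Suc N) y = q ^ N * (q * y - 1)"
    using qy(1) step unfolding funpow_Suc_right by (simp add: funpow_greedy_map_small)
  \<comment> \<open>The competitor consists of the first \<open>k\<close> greedy digits of
    \<open>x\<close>, the digit 0, the word for \<open>w\<close>, and an expansion of
    \<open>e\<close>.\<close>
  let ?v = "q ^ k * x - y"
  have "is_expansion (alphabet m) q x (greedy_expansion x)"
    by (rule is_expansion_greedy[OF d(2,3)])
  then have v: "?v \<in> word_values m q k"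
    using expansion_error_word_values[OF q_pos, of m x "greedy_expansion x" k]
    by (simp add: expansion_error_greedy y_def)
  have "w \<in> word_values m q (Suc N)"
    by (rule word_values_ConsI[OF _ w(1), of 0]) simp_all
  then have vw: "?v * q ^ Suc N + w \<in> word_values m q (k + Suc N)"
    by (rule word_values_append[OF v])
  have e: "0 \<le> e" "e \<le> jmax" "e < (greedy_map ^^ Suc N) y"
    using y w(2) jmax_gt_1 unfolding T by (simp_all add: e_def algebra_simps)
  have "(?v * q ^ Suc N + w + e) / q ^ (k + Suc N) = x"
    using q_pos by (simp add: e_def field_simps power_add)
  then obtain c where c: "is_expansion (alphabet m) q x c" "expansion_error q x c (k + Suc N) = e"
    using word_values_extend[OF vw e(1,2)] by auto
  have "expansion_error q x d (k + Suc N) \<le> expansion_error q x c (k + Suc N)"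
    using d(1) c(1) by (simp add: is_optimal_expansion_def)
  then have "(greedy_map ^^ (Suc N + k)) x \<le> e"
    using c(2) expansion_error_optimal[OF d, of "k + Suc N"] by (simp add: add.commute)
  then show False
    using e(3) unfolding funpow_add y_def by simp
qed

text \<open>The recursion fixes \<open>jmax\<close> and multiplies the distance from it by
  \<open>q\<close>. As \<open>jmax > 1\<close>, the remainders eventually become negative.\<close>

lemma one_remainder_eq: "one_remainder m q i = jmax - q ^ i * (jmax - 1)"
proof (induction i)
  case (Suc i)
  have "one_remainder m q (Suc i) = q * (jmax - q ^ i * (jmax - 1)) - real m"
    using Suc by simp
  also have "\<dots> = jmax - q ^ Suc i * (jmax - 1)"
    using jmax_eq by (simp add: algebra_simps)
  finally show ?case .
qed simp

text \<open>The last condition places the forbidden interval inside [0,1).\<close>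

lemma obtain_nonoptimal_word:
  assumes "q \<notin> base_set_P m"
  obtains N w where "w \<in> word_values m q N" "q ^ N < w" "w < q ^ N + 1"
    "q ^ N + 1 \<le> q ^ Suc N"
proof (cases "q * (q - 1) < 1")
  \<comment> \<open>For \<open>m = 1\<close> and \<open>q\<close> below the golden ratio, the word used in the other case may violate the last
    condition, so a word \<open>10...01\<close> takes its place.\<close>
  case True
  obtain j0 where "1 / (q - 1) < q ^ j0"
    using real_arch_pow[OF q_gt_1] by blast
  then have j0: "1 \<le> q ^ j0 * (q - 1)"
    using q_gt_1 by (simp add: field_simps)
  \<comment> \<open>At \<open>N\<close> the inequality is the required last condition. Its failure
    at \<open>N - 1\<close> says that \<open>q ^ (N - 1) + 1\<close>, the value of
    \<open>10...01\<close>, exceeds \<open>q ^ N\<close>; two nonzero digits need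
    \<open>N \<ge> 2\<close>.\<close>
  define N where "N = (LEAST j. 1 \<le> q ^ j * (q - 1))"
  have N: "1 \<le> q ^ N * (q - 1)"
    unfolding N_def using j0 by (rule LeastI)
  have "q - 1 < q * (q - 1)"
    using q_gt_1 by simp
  then have "\<not> 1 \<le> q ^ 0 * (q - 1)" "\<not> 1 \<le> q ^ 1 * (q - 1)"
    using True by simp_all
  then have "N \<noteq> 0" "N \<noteq> 1"
    using N by metis+
  then obtain j where j: "N = Suc (Suc j)"
    by (metis One_nat_def not0_implies_Suc)
  have "\<not> 1 \<le> q ^ Suc j * (q - 1)"
    using not_less_Least[of "Suc j" "\<lambda>j. 1 \<le> q ^ j * (q - 1)"] j unfolding N_def by simp
  then have "q ^ N < q * q ^ j + real 1"
    unfolding j by (simp add: algebra_simps)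
  moreover have "q * q ^ j + real 1 \<in> word_values m q N"
    unfolding j by (intro word_values_snoc pow_in_word_values m_ge)
  moreover have "q * q ^ j + real 1 < q ^ N + 1"
    using q_gt_1 unfolding j by simp
  moreover have "q ^ N + 1 \<le> q ^ Suc N"
    using N by (simp add: algebra_simps)
  ultimately show ?thesis using that by blast
next
  case False
  let ?r = "one_remainder m q"
  obtain i0 where "jmax / (jmax - 1) < q ^ i0"
    using real_arch_pow[OF q_gt_1] by blast
  then have "?r i0 < 0"
    using jmax_gt_1 unfolding one_remainder_eq by (simp add: field_simps)
  then have i0: "q * ?r i0 < real m"
    using q_pos by (smt (verit) mult_pos_neg of_nat_0_le_iff)
  \<comment> \<open>After \<open>n\<close> digits \<open>m\<close> the remainder of 1 first fails to
    admit another \<open>m\<close>; \<open>p\<close> is the largest digit that still fits. Ending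
    the word with \<open>p + 1\<close> overshoots \<open>q ^ Suc n\<close> by
    \<open>p + 1 - q * ?r n\<close>.\<close>
  define n where "n = (LEAST i. q * ?r i < real m)"
  have n: "q * ?r n < real m"
    unfolding n_def using i0 by (rule LeastI)
  then have "n \<noteq> 0" using q_gt by (cases n) auto
  then obtain n' where n': "n = Suc n'"
    using not0_implies_Suc by blast
  have r_n': "real m \<le> q * ?r n'"
    using not_less_Least[of n' "\<lambda>i. q * ?r i < real m"] n' unfolding n_def by simp
  define p where "p = nat \<lfloor>q * ?r n\<rfloor>"
  have "0 \<le> q * ?r n"
    using r_n' q_pos n' by simp
  then have p: "real p \<le> q * ?r n" "q * ?r n < real p + 1"
    unfolding p_def by (auto simp: of_nat_floor)
  have "p < m" using p(1) n by linarith
  \<comment> \<open>Equality would put \<open>q\<close> in \<open>base_set_P m\<close>, with index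
    \<open>n\<close> and digit \<open>p\<close>, or with index \<open>n'\<close> and digit
    \<open>m\<close> if \<open>p = 0\<close>.\<close>
  have "q * ?r n \<noteq> real p"
  proof
    assume eq: "q * ?r n = real p"
    show False
    proof (cases "p = 0")
      case True
      then have "q * ?r n' = real m" using eq q_pos n' by simp
      moreover from this have "n' \<noteq> 0" using q_gt by (cases n') auto
      ultimately show False using assms m_ge unfolding base_set_P_iff by force
    next
      case False
      then show False using assms eq \<open>p < m\<close> n' unfolding base_set_P_iff by force
    qed
  qed
  then have "q ^ Suc n < q * (q ^ n - ?r n) + real (Suc p)"
    "q * (q ^ n - ?r n) + real (Suc p) < q ^ Suc n + 1"
    using p by (auto simp: algebra_simps)
  moreover have "q * (q ^ n - ?r n) + real (Suc p) \<in> word_values m q (Suc n)"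
    using \<open>p < m\<close> by (intro word_values_snoc pow_minus_one_remainder_in_word_values) simp
  moreover have "q ^ Suc n + 1 \<le> q ^ Suc (Suc n)"
  proof -
    have "1 * 1 \<le> q ^ n * (q * (q - 1))"
      using False q_gt_1 by (intro mult_mono one_le_power) auto
    then show ?thesis by (simp add: algebra_simps)
  qed
  ultimately show ?thesis using that by blast
qed

section \<open>Measurability and one-sided affinity of the greedy map\<close>

lemma measurable_greedy_map [measurable]: "greedy_map \<in> borel_measurable borel"
  unfolding greedy_map_def greedy_digit_def by measurable

text \<open>The digit depends only on the floor of \<open>q * x\<close>, which stays constant to the
  right until the next integer is reached.\<close>

lemma greedy_map_right_affine:
  assumes "0 \<le> x"
  obtains e where "0 < e" "\<And>t. 0 \<le> t \<Longrightarrow> t < e \<Longrightarrow> greedy_map (x + t) = greedy_map x + q * t"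
proof -
  define e where "e = (of_int \<lfloor>q * x\<rfloor> + 1 - q * x) / q"
  have "greedy_map (x + t) = greedy_map x + q * t" if "0 \<le> t" "t < e" for t
  proof -
    have "q * t < of_int \<lfloor>q * x\<rfloor> + 1 - q * x" "0 \<le> q * t"
      using that q_pos by (auto simp: e_def field_simps)
    then have "\<lfloor>q * (x + t)\<rfloor> = \<lfloor>q * x\<rfloor>"
      by (intro floor_unique) (simp_all add: distrib_left, linarith+)
    then show ?thesis
      by (simp add: greedy_map_def greedy_digit_def distrib_left)
  qed
  moreover have "0 < e"
    using q_pos unfolding e_def by (intro divide_pos_pos) linarith+
  ultimately show ?thesis using that by blast
qed

lemma funpow_greedy_map_right_affine:
  assumes "0 \<le> x"
  shows "\<exists>e>0. \<forall>t. 0 \<le> t \<longrightarrow> t < e \<longrightarrow> (greedy_map ^^ n) (x + t) = (greedy_map ^^ n) x + q ^ n * t"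
proof (induction n)
  case 0
  show ?case by (auto intro: exI[of _ 1])
next
  case (Suc n)
  then obtain e where e: "0 < e" and
    e_eq: "\<And>t. 0 \<le> t \<Longrightarrow> t < e \<Longrightarrow> (greedy_map ^^ n) (x + t) = (greedy_map ^^ n) x + q ^ n * t"
    by blast
  have "0 \<le> (greedy_map ^^ n) x"
    using assms by (induction n) (auto intro: greedy_map_nonneg)
  then obtain e' where e': "0 < e'" and
    e'_eq: "\<And>t. 0 \<le> t \<Longrightarrow> t < e' \<Longrightarrow>
      greedy_map ((greedy_map ^^ n) x + t) = greedy_map ((greedy_map ^^ n) x) + q * t"
    using greedy_map_right_affine by metis
  show ?case
  proof (intro exI[of _ "min e (e' / q ^ n)"] conjI allI impI)
    fix t assume t: "0 \<le> t" "t < min e (e' / q ^ n)"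
    then have "q ^ n * t < e'" "0 \<le> q ^ n * t"
      using q_pos by (auto simp: field_simps)
    then show "(greedy_map ^^ Suc n) (x + t) = (greedy_map ^^ Suc n) x + q ^ Suc n * t"
      using e_eq[of t] e'_eq[of "q ^ n * t"] t by simp
  qed (use e e' q_pos in simp)
qed

end

section \<open>Points whose greedy orbit avoids an interval: measure zero\<close>

locale greedy_map_hole = noninteger_base +
  fixes \<alpha> \<beta> :: real
  assumes hole: "0 \<le> \<alpha>" "\<alpha> < \<beta>" "\<beta> \<le> 1"
begin

definition avoiders :: "real set" where
  "avoiders = {x \<in> {0..jmax}. \<forall>k. (greedy_map ^^ k) x \<notin> {\<alpha>..<\<beta>}}"

definition avoiders_measure :: "real \<Rightarrow> real \<Rightarrow> real" where
  "avoiders_measure a b = measure lebesgue (avoiders \<inter> {a..<b})"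

lemma avoiders_borel: "avoiders \<in> sets borel"
proof -
  have "{x \<in> space borel. 0 \<le> x \<and> x \<le> jmax \<and>
      (\<forall>k. \<not> (\<alpha> \<le> (greedy_map ^^ k) x \<and> (greedy_map ^^ k) x < \<beta>))} \<in> sets borel"
    by measurable
  then show ?thesis by (simp add: avoiders_def conj_assoc)
qed

lemma avoiders_Int_lmeasurable: "avoiders \<inter> {a..<b} \<in> lmeasurable"
proof (rule fmeasurableI2)
  show "{a..b} \<in> lmeasurable" by simp
  have "avoiders \<inter> {a..<b} \<in> sets borel" using avoiders_borel by auto
  then show "avoiders \<inter> {a..<b} \<in> sets lebesgue" by simp
qed auto

lemma greedy_map_avoiders:
  assumes "x \<in> avoiders"
  shows "greedy_map x \<in> avoiders"
proof -
  have "(greedy_map ^^ k) (greedy_map x) \<notin> {\<alpha>..<\<beta>}" for k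
    using assms unfolding avoiders_def funpow_swap1[symmetric]
    by (metis (mono_tags, lifting) comp_apply funpow.simps(2) mem_Collect_eq)
  then show ?thesis
    using assms greedy_map_nonneg greedy_map_le_jmax by (auto simp: avoiders_def)
qed

lemma avoiders_measure_split:
  assumes "a \<le> b" "b \<le> c"
  shows "avoiders_measure a c \<le> avoiders_measure a b + avoiders_measure b c"
proof -
  have "avoiders \<inter> {a..<c} = (avoiders \<inter> {a..<b}) \<union> (avoiders \<inter> {b..<c})"
    using assms by auto
  then show ?thesis
    unfolding avoiders_measure_def using avoiders_Int_lmeasurable
    by (auto intro!: measure_Un_le fmeasurableD)
qed

lemma avoiders_measure_le_length:
  assumes "a \<le> b"
  shows "avoiders_measure a b \<le> b - a"
proof -
  have "avoiders_measure a b \<le> measure lebesgue {a..b}"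
    unfolding avoiders_measure_def using avoiders_Int_lmeasurable
    by (intro measure_mono_fmeasurable) auto
  then show ?thesis using assms by simp
qed

text \<open>On the cell from \<open>i / q\<close> to \<open>(i + 1) / q\<close> the greedy map is
  \<open>q * x - i\<close> and preserves \<open>avoiders\<close>; its inverse branch contracts by
  \<open>1 / q\<close>.\<close>

lemma avoiders_measure_scale:
  assumes "i \<le> m" "0 \<le> a" "b \<le> 1"
  shows "avoiders_measure ((real i + a) / q) ((real i + b) / q) \<le> avoiders_measure a b / q"
proof -
  let ?f = "\<lambda>y. (1 / q) *\<^sub>R y + real i / q"
  have "avoiders \<inter> {(real i + a) / q..<(real i + b) / q} \<subseteq> ?f ` (avoiders \<inter> {a..<b})"
  proof
    fix x assume x: "x \<in> avoiders \<inter> {(real i + a) / q..<(real i + b) / q}"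
    then have qx: "real i + a \<le> q * x" "q * x < real i + b"
      using q_pos by (auto simp: field_simps)
    then have "greedy_map x = q * x - real i"
      using assms by (intro greedy_map_eq) auto
    then have "q * x - real i \<in> avoiders \<inter> {a..<b}"
      using x qx greedy_map_avoiders[of x] by auto
    moreover have "x = ?f (q * x - real i)"
      using q_pos by (simp add: field_simps)
    ultimately show "x \<in> ?f ` (avoiders \<inter> {a..<b})" by (rule rev_image_eqI)
  qed
  moreover have "?f ` (avoiders \<inter> {a..<b}) \<in> lmeasurable"
    using avoiders_Int_lmeasurable by (rule lmeasurable_affine_image)
  ultimately have "avoiders_measure ((real i + a) / q) ((real i + b) / q) \<le>
      measure lebesgue (?f ` (avoiders \<inter> {a..<b}))"
    unfolding avoiders_measure_def using avoiders_Int_lmeasurable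
    by (intro measure_mono_fmeasurable) auto
  also have "\<dots> = avoiders_measure a b / q"
    using measure_lebesgue_affine[of "1 / q" "real i / q" "avoiders \<inter> {a..<b}"] q_pos
    by (simp add: avoiders_measure_def)
  finally show ?thesis .
qed

abbreviation "unit_measure \<equiv> avoiders_measure 0 1"

lemma avoiders_measure_cells:
  "k + j \<le> m + 1 \<Longrightarrow>
    avoiders_measure (real k / q) (real (k + j) / q) \<le> real j * unit_measure / q"
proof (induction j)
  case 0
  then show ?case using avoiders_measure_le_length[of "real k / q" "real k / q"] by simp
next
  case (Suc j)
  have "avoiders_measure (real k / q) (real (k + Suc j) / q) \<le>
      avoiders_measure (real k / q) (real (k + j) / q) +
      avoiders_measure (real (k + j) / q) (real (k + Suc j) / q)"
    using q_pos by (intro avoiders_measure_split divide_right_mono) auto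
  also have "avoiders_measure (real (k + j) / q) (real (k + Suc j) / q) \<le> unit_measure / q"
    using avoiders_measure_scale[of "k + j" 0 1] Suc.prems by (simp add: algebra_simps)
  finally show ?case
    using Suc by (simp add: add_divide_distrib algebra_simps)
qed

lemma digit_split:
  assumes "0 \<le> b" "b \<le> 1"
  obtains k b' where "k \<le> m" "0 \<le> b'" "b' \<le> 1" "b = (real k + b') / q"
    "real k \<le> q * b" "q * b < real k + 1"
proof -
  define k where "k = nat \<lfloor>q * b\<rfloor>"
  have k: "real k \<le> q * b" "q * b < real k + 1"
    using assms q_pos unfolding k_def by (auto simp: of_nat_floor)
  have "q * b \<le> q" using assms q_pos by simp
  then have "k \<le> m" using k(1) q_lt by linarith
  with k show ?thesis
    using q_pos by (intro that[of k "q * b - real k"]) auto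
qed

text \<open>
  Cutting off the first digit contracts the error term by \<open>1 / q\<close>. Initial intervals come first,
  because cutting a general interval at a cell boundary leaves an initial one on the right.
\<close>

lemma avoiders_measure_initial_aux:
  "\<lbrakk>0 \<le> b; b \<le> 1\<rbrakk> \<Longrightarrow> avoiders_measure 0 b \<le> unit_measure * b + 1 / q ^ n"
proof (induction n arbitrary: b)
  case 0
  have "0 \<le> unit_measure * b" using 0 by (simp add: avoiders_measure_def)
  then show ?case using avoiders_measure_le_length[of 0 b] 0 by simp
next
  case (Suc n)
  obtain k b' where k: "k \<le> m" "0 \<le> b'" "b' \<le> 1" "b = (real k + b') / q" "real k \<le> q * b"
    using digit_split[OF Suc.prems] by metis
  have "avoiders_measure 0 b \<le> avoiders_measure 0 (real k / q) + avoiders_measure (real k / q) b"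
    using k q_pos by (intro avoiders_measure_split) (auto simp: field_simps)
  also have "avoiders_measure 0 (real k / q) \<le> real k * unit_measure / q"
    using avoiders_measure_cells[of 0 k] k(1) by simp
  also have "avoiders_measure (real k / q) b \<le> avoiders_measure 0 b' / q"
    using avoiders_measure_scale[of k 0 b'] k by simp
  also have "\<dots> \<le> (unit_measure * b' + 1 / q ^ n) / q"
    using Suc.IH[OF k(2,3)] q_pos by (intro divide_right_mono) auto
  finally show ?case
    unfolding k(4) using q_pos by (simp add: field_simps)
qed

lemma le_if_le_plus_power:
  assumes "\<And>n. (a::real) \<le> b + 1 / q ^ n"
  shows "a \<le> b"
proof (rule LIMSEQ_le_const)
  have "(\<lambda>n. b + (1 / q) ^ n) \<longlonglongrightarrow> b + 0"
    using q_gt_1 by (intro tendsto_add tendsto_const LIMSEQ_power_zero) auto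
  then show "(\<lambda>n. b + 1 / q ^ n) \<longlonglongrightarrow> b"
    by (simp add: power_one_over)
qed (use assms in blast)

lemma avoiders_measure_initial:
  "\<lbrakk>0 \<le> b; b \<le> 1\<rbrakk> \<Longrightarrow> avoiders_measure 0 b \<le> unit_measure * b"
  using avoiders_measure_initial_aux by (blast intro: le_if_le_plus_power)

lemma avoiders_measure_interval_aux:
  "\<lbrakk>0 \<le> a; a \<le> b; b \<le> 1\<rbrakk> \<Longrightarrow> avoiders_measure a b \<le> unit_measure * (b - a) + 1 / q ^ n"
proof (induction n arbitrary: a b)
  case 0
  have "0 \<le> unit_measure * (b - a)" using 0 by (simp add: avoiders_measure_def)
  then show ?case using avoiders_measure_le_length[of a b] 0 by simp
next
  case (Suc n)
  obtain k a' where k: "k \<le> m" "0 \<le> a'" "a' \<le> 1" "a = (real k + a') / q"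
    "real k \<le> q * a" "q * a < real k + 1"
    using digit_split[of a] Suc.prems by (metis order_trans)
  obtain l b' where l: "l \<le> m" "0 \<le> b'" "b' \<le> 1" "b = (real l + b') / q"
    "real l \<le> q * b" "q * b < real l + 1"
    using digit_split[of b] Suc.prems by (metis order_trans)
  have qab: "q * a \<le> q * b" using Suc.prems q_pos by simp
  then have "k \<le> l" using k(5) l(6) by linarith
  show ?case
  proof (cases "k = l")
    case True
    then have "a' \<le> b'" using qab k(4) l(4) q_pos by simp
    have "avoiders_measure a b \<le> avoiders_measure a' b' / q"
      using avoiders_measure_scale[of k a' b'] k l True by simp
    also have "\<dots> \<le> (unit_measure * (b' - a') + 1 / q ^ n) / q"
      using Suc.IH[OF k(2) \<open>a' \<le> b'\<close> l(3)] q_pos by (intro divide_right_mono) auto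
    also have "\<dots> = unit_measure * (b - a) + 1 / q ^ Suc n"
      unfolding k(4) l(4) True using q_pos by (simp add: field_simps)
    finally show ?thesis .
  next
    case False
    then obtain j where j: "l = Suc k + j" using \<open>k \<le> l\<close> less_iff_Suc_add[of k l] by auto
    \<comment> \<open>The pieces are the rest of the cell of \<open>a\<close>, \<open>j\<close> full
      cells, and an initial part of the cell of \<open>b\<close>. The last is bounded without an
      error term, so only the first piece contributes one.\<close>
    have "avoiders_measure a b \<le> avoiders_measure a (real (Suc k) / q) + avoiders_measure (real (Suc k) / q) b"
      using k l j q_pos by (intro avoiders_measure_split) (auto simp: field_simps)
    also have "avoiders_measure (real (Suc k) / q) b \<le>
        avoiders_measure (real (Suc k) / q) (real l / q) + avoiders_measure (real l / q) b"
      using k l j q_pos by (intro avoiders_measure_split) (auto simp: field_simps)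
    also have "avoiders_measure a (real (Suc k) / q) \<le> avoiders_measure a' 1 / q"
      using avoiders_measure_scale[of k a' 1] k by (simp add: add.commute)
    also have "avoiders_measure a' 1 / q \<le> (unit_measure * (1 - a') + 1 / q ^ n) / q"
      using Suc.IH[OF k(2,3)] q_pos by (intro divide_right_mono) auto
    also have "avoiders_measure (real (Suc k) / q) (real l / q) \<le> real j * unit_measure / q"
      using avoiders_measure_cells[of "Suc k" j] l(1) j by simp
    also have "avoiders_measure (real l / q) b \<le> avoiders_measure 0 b' / q"
      using avoiders_measure_scale[of l 0 b'] l by simp
    also have "avoiders_measure 0 b' / q \<le> unit_measure * b' / q"
      using avoiders_measure_initial[OF l(2,3)] q_pos by (intro divide_right_mono) auto
    finally show ?thesis
      unfolding k(4) l(4) j using q_pos by (simp add: field_simps)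
  qed
qed

lemma avoiders_measure_interval:
  "\<lbrakk>0 \<le> a; a \<le> b; b \<le> 1\<rbrakk> \<Longrightarrow> avoiders_measure a b \<le> unit_measure * (b - a)"
  using avoiders_measure_interval_aux by (blast intro: le_if_le_plus_power)

lemma negligible_avoiders_unit: "negligible (avoiders \<inter> {0..<1})"
proof -
  have "avoiders \<inter> {\<alpha>..<\<beta>} = {}"
    unfolding avoiders_def by (auto dest!: spec[of _ "0::nat"])
  then have "avoiders_measure \<alpha> \<beta> = 0"
    by (simp add: avoiders_measure_def)
  moreover have "unit_measure \<le> avoiders_measure 0 \<alpha> + avoiders_measure \<alpha> 1"
    "avoiders_measure \<alpha> 1 \<le> avoiders_measure \<alpha> \<beta> + avoiders_measure \<beta> 1"
    using hole by (auto intro: avoiders_measure_split)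
  moreover have "avoiders_measure 0 \<alpha> \<le> unit_measure * \<alpha>" "avoiders_measure \<beta> 1 \<le> unit_measure * (1 - \<beta>)"
    using hole by (auto intro: avoiders_measure_initial avoiders_measure_interval)
  \<comment> \<open>The hole contributes nothing, so
    \<open>unit_measure \<le> unit_measure * (\<alpha> + 1 - \<beta>)\<close>.\<close>
  ultimately have "unit_measure * (\<beta> - \<alpha>) \<le> 0"
    by (simp add: algebra_simps)
  then have "unit_measure = 0"
    using hole by (simp add: mult_le_0_iff avoiders_measure_def measure_le_0_iff)
  then show ?thesis
    using avoiders_Int_lmeasurable by (simp add: avoiders_measure_def negligible_iff_measure)
qed

text \<open>The right end points are the iterates of 1 under the inverse branch
  \<open>(y + m) / q\<close>, which fixes \<open>jmax\<close>. Points from 1 on have greedy digit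
  \<open>m\<close>, so this branch reaches them from the preceding interval.\<close>

lemma negligible_avoiders_below:
  "negligible (avoiders \<inter> {0..<jmax - (jmax - 1) / q ^ n})"
proof (induction n)
  case 0
  then show ?case using negligible_avoiders_unit by simp
next
  case (Suc n)
  let ?f = "\<lambda>y. (1 / q) *\<^sub>R y + real m / q" and ?A = "avoiders \<inter> {0..<jmax - (jmax - 1) / q ^ n}"
  have "avoiders \<inter> {0..<jmax - (jmax - 1) / q ^ Suc n} \<subseteq> avoiders \<inter> {0..<1} \<union> ?f ` ?A"
  proof
    fix x assume x: "x \<in> avoiders \<inter> {0..<jmax - (jmax - 1) / q ^ Suc n}"
    show "x \<in> avoiders \<inter> {0..<1} \<union> ?f ` ?A"
    proof (cases "x < 1")
      case False
      then have "real m \<le> q * x"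
        using q_gt q_pos by (smt (verit) mult_le_cancel_left1)
      then have T: "greedy_map x = q * x - real m"
        by (intro greedy_map_eq) auto
      have "q * x < q * (jmax - (jmax - 1) / q ^ Suc n)"
        using x q_pos by simp
      also have "\<dots> = jmax + real m - (jmax - 1) / q ^ n"
        unfolding right_diff_distrib jmax_eq using q_pos by simp
      finally have "q * x - real m \<in> ?A"
        using greedy_map_avoiders[of x] x T \<open>real m \<le> q * x\<close> by auto
      moreover have "x = ?f (q * x - real m)"
        using q_pos by (simp add: field_simps)
      ultimately show ?thesis by blast
    qed (use x in auto)
  qed
  moreover have "negligible (?f ` ?A)"
    using Suc lmeasurable_affine_image[of ?A "1 / q" "real m / q"]
      measure_lebesgue_affine[of "1 / q" "real m / q" ?A]
    by (simp add: negligible_iff_measure)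
  ultimately show ?case
    using negligible_avoiders_unit by (blast intro: negligible_subset negligible_Un)
qed

lemma negligible_avoiders: "negligible avoiders"
proof -
  have "avoiders \<subseteq> insert jmax (\<Union>n. avoiders \<inter> {0..<jmax - (jmax - 1) / q ^ n})"
  proof
    fix x assume x: "x \<in> avoiders"
    show "x \<in> insert jmax (\<Union>n. avoiders \<inter> {0..<jmax - (jmax - 1) / q ^ n})"
    proof (cases "x = jmax")
      case False
      then have "x < jmax" "0 \<le> x" using x by (auto simp: avoiders_def)
      moreover obtain n where "(jmax - 1) / (jmax - x) < q ^ n"
        using real_arch_pow[OF q_gt_1] by blast
      ultimately have "x < jmax - (jmax - 1) / q ^ n"
        using q_pos by (simp add: field_simps)
      then show ?thesis using x \<open>0 \<le> x\<close> by auto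
    qed simp
  qed
  moreover have "negligible (insert jmax (\<Union>n. avoiders \<inter> {0..<jmax - (jmax - 1) / q ^ n}))"
    unfolding negligible_insert using negligible_avoiders_below
    by (intro negligible_countable_Union) auto
  ultimately show ?thesis by (rule negligible_subset[rotated])
qed

section \<open>Points whose greedy orbit avoids an interval: nowhere density\<close>

text \<open>A nonempty open set is not null, so the interior of the closure contains some
  \<open>x\<close> outside \<open>avoiders\<close>. An open interval to the right of
  \<open>x\<close> misses \<open>avoiders\<close>, hence its closure, although it meets that
  interior.\<close>

lemma nowhere_dense_avoiders: "nowhere_dense avoiders"
  unfolding nowhere_dense_def
proof (rule ccontr)
  let ?U = "interior (closure avoiders)"
  assume ne: "?U \<noteq> {}"
  have "?U \<subseteq> {0..jmax}"
  proof -
    have "avoiders \<subseteq> {0..jmax}" by (auto simp: avoiders_def)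
    then have "closure avoiders \<subseteq> {0..jmax}" by (rule closure_minimal) simp
    then show ?thesis using interior_subset by blast
  qed
  have "\<not> ?U \<subseteq> avoiders"
  proof
    assume "?U \<subseteq> avoiders"
    then have "negligible ?U"
      by (rule negligible_subset[OF negligible_avoiders])
    then show False
      using ne open_not_negligible[OF open_interior] by blast
  qed
  then obtain x where x: "x \<in> ?U" "x \<notin> avoiders" by blast
  then obtain k where k: "\<alpha> \<le> (greedy_map ^^ k) x" "(greedy_map ^^ k) x < \<beta>" and "0 \<le> x"
    using \<open>?U \<subseteq> {0..jmax}\<close> by (auto simp: avoiders_def)
  obtain e where e: "0 < e"
    "\<And>t. 0 \<le> t \<Longrightarrow> t < e \<Longrightarrow> (greedy_map ^^ k) (x + t) = (greedy_map ^^ k) x + q ^ k * t"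
    using funpow_greedy_map_right_affine[OF \<open>0 \<le> x\<close>] by blast
  \<comment> \<open>The iterate has slope \<open>q ^ k\<close> to the right of \<open>x\<close>; the
    second bound keeps it below \<open>\<beta>\<close>.\<close>
  define e' where "e' = min e ((\<beta> - (greedy_map ^^ k) x) / q ^ k)"
  have "0 < e'" using e k q_pos by (simp add: e'_def)
  have "{x<..<x + e'} \<inter> avoiders = {}"
  proof (intro equals0I)
    fix y assume y: "y \<in> {x<..<x + e'} \<inter> avoiders"
    then have "(greedy_map ^^ k) y = (greedy_map ^^ k) x + q ^ k * (y - x)"
      using e(2)[of "y - x"] by (auto simp: e'_def)
    moreover have "y - x < (\<beta> - (greedy_map ^^ k) x) / q ^ k"
      using y by (auto simp: e'_def)
    then have "q ^ k * (y - x) < \<beta> - (greedy_map ^^ k) x"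
      using q_pos by (simp add: pos_less_divide_eq mult.commute)
    moreover have "0 \<le> q ^ k * (y - x)"
      using y q_pos by simp
    ultimately have "(greedy_map ^^ k) y \<in> {\<alpha>..<\<beta>}"
      using k by simp
    then show False using y by (auto simp: avoiders_def)
  qed
  then have disj: "{x<..<x + e'} \<inter> closure avoiders = {}"
    using open_Int_closure_eq_empty[of "{x<..<x + e'}" avoiders] by simp
  obtain d where d: "0 < d" "ball x d \<subseteq> ?U"
    using x(1) open_interior open_contains_ball by blast
  define y where "y = x + min d e' / 2"
  have "y \<in> {x<..<x + e'}" "y \<in> ball x d"
    using d \<open>0 < e'\<close> by (auto simp: y_def dist_real_def)
  then show False
    using disj d(2) interior_subset by blast
qed

end

theorem theorem1:
  fixes m :: nat and q :: real
  assumes "m \<ge> 1" and "q \<in> {real m<..<real m + 1}"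
  shows "(q \<in> base_set_P m \<longrightarrow>
            (\<forall>x\<in>J_interval m q. \<exists>d. is_optimal_expansion (alphabet m) q x d)) \<and>
         (q \<notin> base_set_P m \<longrightarrow>
            nowhere_dense {x \<in> J_interval m q. \<exists>d. is_optimal_expansion (alphabet m) q x d} \<and>
            {x \<in> J_interval m q. \<exists>d. is_optimal_expansion (alphabet m) q x d} \<in> null_sets lebesgue)"
    (is "_ \<and> (_ \<longrightarrow> nowhere_dense ?S \<and> _)")
proof (intro conjI impI)
  interpret noninteger_base m q
    using assms by unfold_locales auto
  have J: "J_interval m q = {0..jmax}"
    by (simp add: J_interval_def jmax_def)
  show "\<forall>x\<in>J_interval m q. \<exists>d. is_optimal_expansion (alphabet m) q x d" if "q \<in> base_set_P m"
    unfolding J using is_optimal_expansion_greedy[OF that] by (metis atLeastAtMost_iff)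
  assume "q \<notin> base_set_P m"
  then obtain N w where w: "w \<in> word_values m q N" "q ^ N < w" "w < q ^ N + 1"
    "q ^ N + 1 \<le> q ^ Suc N"
    by (rule obtain_nonoptimal_word)
  \<comment> \<open>These are the end points from \<open>optimal_orbit_avoids\<close>; the last
    property of \<open>N\<close> gives \<open>\<beta> \<le> 1\<close>.\<close>
  define \<alpha> \<beta> where "\<alpha> = w / q ^ Suc N" and "\<beta> = (q ^ N + 1) / q ^ Suc N"
  have "0 < q ^ N" using q_pos by simp
  then have "0 < w" using w(2) by linarith
  then have "0 \<le> \<alpha>" "\<alpha> < \<beta>" "\<beta> \<le> 1"
    using w q_pos unfolding \<alpha>_def \<beta>_def by (auto intro: divide_strict_right_mono simp del: power_Suc)
  then interpret greedy_map_hole m q \<alpha> \<beta>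
    by unfold_locales
  have sub: "?S \<subseteq> avoiders"
    using optimal_orbit_avoids[OF w(1,2)]
    unfolding avoiders_def J unfolding \<alpha>_def \<beta>_def by auto
  show "nowhere_dense ?S"
    using nowhere_dense_avoiders interior_mono[OF closure_mono[OF sub]]
    by (simp add: nowhere_dense_def)
  show "?S \<in> null_sets lebesgue"
    using negligible_subset[OF negligible_avoiders sub]
    by (simp add: negligible_iff_null_sets)
qed

end
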